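(* Let $q \geq 4$ be a prime power and $n = q^{2}-1$. Then for every integer $i$ with $1 \leq i \leq q-3$ there exists a convolutional code with parameters $(n,\; n-2q+1,\; 2i+1;\; 1,\; d_{free} \geq q+i+3)_{q}$.
   Context: A matrix $G(D)=(g_{ij})\in \mathbb{F}_q[D]^{k\times n}$ is called basic if it has a polynomial right inverse. Its $i$-th row degree is $\gamma_i=\max_{1\le j\le n}\deg g_{ij}$ and its overall constraint length is $\gamma=\sum_{i=1}^k\gamma_i$. A basic generator matrix of a code is called reduced if its overall constraint length is the smallest among all basic generator matrices of that code. A convolutional code with parameters $(n,k,\gamma;\mu,d_f)_q$ is a submodule $C=\{\mathbf{u}(D)G(D) : \mathbf{u}(D)\in\mathbb{F}_q[D]^k\}$ of $\mathbb{F}_q[D]^n$ generated by a reduced basic matrix $G(D)\in\mathbb{F}_q[D]^{k\times n}$, where $n$ is the length, $k$ the dimension, $\gamma=\sum_{i=1}^k\gamma_i$ the degree, $\mu=\max_{1\le i\le k}\gamma_i$ the memory, and $d_f=d_{free}=\min\{\mathrm{wt}(\mathbf{v}(D)) : \mathbf{v}(D)\in C,\ \mathbf{v}(D)\neq 0\}$ the free distance; here $\mathrm{wt}(\mathbf{v}(D))$ is the total number of nonzero coefficients over all $n$ polynomial components of $\mathbf{v}(D)$. Writing "$d_{free}\ge a$" in the last slot means the free distance is at least $a$. *)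

theory Defs
  imports
    "HOL-Computational_Algebra.Polynomial"
    "HOL-Number_Theory.Prime_Powers"
    "HOL-Library.Cardinality"
    "Jordan_Normal_Form.Matrix"
begin

(* The dimension constraint on H is needed: matrices carry their dimensions at run time and
   the product is total, so inverts_mat alone does not force H to be n x k. *)
definition basic_matrix :: "'a::field poly mat \<Rightarrow> bool" where
  "basic_matrix G \<longleftrightarrow> (\<exists>H \<in> carrier_mat (dim_col G) (dim_row G). inverts_mat G H)"

(* A basic matrix has no zero row (when it has columns), so the convention degree 0 = 0
   has no influence on its row degrees. *)
definition row_degree :: "'a::field poly mat \<Rightarrow> nat \<Rightarrow> nat" where
  "row_degree G i = Max ((\<lambda>j. degree (G $$ (i, j))) ` {..<dim_col G})"

definition overall_constraint_length :: "'a::field poly mat \<Rightarrow> nat" where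
  "overall_constraint_length G = (\<Sum>i<dim_row G. row_degree G i)"

definition memory :: "'a::field poly mat \<Rightarrow> nat" where
  "memory G = Max (row_degree G ` {..<dim_row G})"

(* transpose_mat G *v u is the row vector u G. *)
definition generated_code :: "'a::field poly mat \<Rightarrow> 'a poly vec set" where
  "generated_code G = {transpose_mat G *\<^sub>v u | u. u \<in> carrier_vec (dim_row G)}"

definition reduced_basic_matrix :: "'a::field poly mat \<Rightarrow> bool" where
  "reduced_basic_matrix G \<longleftrightarrow> basic_matrix G \<and>
     (\<forall>G'. basic_matrix G' \<and> generated_code G' = generated_code G \<longrightarrow>
        overall_constraint_length G \<le> overall_constraint_length G')"

definition weight :: "'a::field poly vec \<Rightarrow> nat" where
  "weight v = (\<Sum>j<dim_vec v. card {m. coeff (v $ j) m \<noteq> 0})"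

(* An infimum in nat, hence a minimum as soon as C has a nonzero element
   (and 0 by convention if it has none). *)
definition free_distance :: "'a::field poly vec set \<Rightarrow> nat" where
  "free_distance C = Inf {weight v | v. v \<in> C \<and> v \<noteq> 0\<^sub>v (dim_vec v)}"

(* C has length n, dimension k, degree \<gamma> and memory \<mu>. *)
definition convolutional_code ::
  "nat \<Rightarrow> nat \<Rightarrow> nat \<Rightarrow> nat \<Rightarrow> 'a::field poly vec set \<Rightarrow> bool" where
  "convolutional_code n k \<gamma> \<mu> C \<longleftrightarrow>
     (\<exists>G \<in> carrier_mat k n. reduced_basic_matrix G \<and> C = generated_code G \<and>
        overall_constraint_length G = \<gamma> \<and> memory G = \<mu>)"

end

(* Let F be the field with q elements and let C be the kernel of H0 - D H1, where H0 (rank 2q - 1) and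
   H1 (rank 2i + 1, padded with zero rows) are BCH parity check matrices over F of length q^2 - 1. Their
   columns belong to the nonzero elements of the field with q^2 elements, and they check the powers
   0, ..., q - 1 and q + 1, ..., q + 1 + i together with their conjugates. The lowest coefficient of a
   nonzero codeword lies in ker H0 and the highest one in ker H1. If they are different coefficients, the
   weight is at least the sum of the two minimum distances; otherwise the coefficient is in both kernels
   and the powers 0, ..., q + 1 + i all vanish on it. The BCH bound applies in either case.

   All these parity checks are linearly independent, so they extend to an invertible matrix, in whose
   inverse one reads off a generator matrix with 2i + 1 rows of degree 1 and all other rows constant.
   It is reduced because the constant words of C only have dimension n - 2(q + i). *)
theory Submission
  imports
    Defs
    "Jordan_Normal_Form.Determinant"
    "HOL-Algebra.Algebraic_Closure_Type"
    "HOL-Number_Theory.Residues"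
begin

no_notation fps_nth (infixl "$" 75)
hide_const (open) up_ring.coeff up_ring.monom Polynomials.lead_coeff Polynomials.degree
  module.smult Divisibility.prime

subsection \<open>Linearly independent families of functionals\<close>

text \<open>Matrices are plain functions of two indices, so rows can be appended and index ranges
  cut or shifted without carrier sets.\<close>

definition independent_rows :: "nat \<Rightarrow> nat \<Rightarrow> (nat \<Rightarrow> nat \<Rightarrow> 'a::field) \<Rightarrow> bool" where
  "independent_rows m n R \<longleftrightarrow>
     (\<forall>c. (\<forall>l<n. (\<Sum>j<m. c j * R j l) = 0) \<longrightarrow> (\<forall>j<m. c j = 0))"

lemma inverse_rows_commute:
  fixes A B :: "nat \<Rightarrow> nat \<Rightarrow> 'a::field"
  assumes AB: "\<And>i j. i < m \<Longrightarrow> j < m \<Longrightarrow> (\<Sum>l<m. A i l * B l j) = of_bool (i = j)"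
    and "i < m" "j < m"
  shows "(\<Sum>l<m. B i l * A l j) = of_bool (i = j)"
proof -
  define MA where "MA = mat m m (\<lambda>(i, l). A i l)"
  define MB where "MB = mat m m (\<lambda>(i, l). B i l)"
  have "MA * MB = 1\<^sub>m m"
    by (rule eq_matI)
      (auto simp: MA_def MB_def scalar_prod_def AB simp flip: lessThan_atLeast0)
  then have BA: "MB * MA = 1\<^sub>m m"
    by (rule mat_mult_left_right_inverse[rotated 2]) (auto simp: MA_def MB_def)
  have "(\<Sum>l<m. B i l * A l j) = (MB * MA) $$ (i, j)"
    using assms(2,3) by (simp add: MA_def MB_def scalar_prod_def lessThan_atLeast0)
  then show ?thesis
    using assms(2,3) by (simp add: BA)
qed

text \<open>Carries the dimension counts below: an identity of size \<open>m\<close> cannot factor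
  through a smaller size \<open>r\<close>. Zero columns would make \<open>A\<close> square, so the
  product in the other order would be the identity as well, although its column \<open>r\<close> is
  zero.\<close>

lemma right_inverse_imp_rows_le:
  fixes A B :: "nat \<Rightarrow> nat \<Rightarrow> 'a::field"
  assumes AB: "\<And>i j. i < m \<Longrightarrow> j < m \<Longrightarrow> (\<Sum>l<r. A i l * B l j) = of_bool (i = j)"
  shows "m \<le> r"
proof (rule ccontr)
  assume "\<not> m \<le> r"
  then have rm: "r < m" by simp
  define A' where "A' = (\<lambda>i l. if l < r then A i l else 0)"
  have *: "(\<Sum>l<m. A' i l * B l j) = of_bool (i = j)" if "i < m" "j < m" for i j
  proof -
    have "(\<Sum>l<m. A' i l * B l j) = (\<Sum>l<r. A i l * B l j)"
      using rm by (intro sum.mono_neutral_cong_right) (auto simp: A'_def)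
    with AB that show ?thesis by simp
  qed
  have "(\<Sum>l<m. B r l * A' l r) = of_bool (r = r)"
    by (rule inverse_rows_commute[where A = A' and B = B]) (use rm * in auto)
  then show False
    by (simp add: A'_def)
qed

lemma independent_rows_extend1:
  fixes R :: "nat \<Rightarrow> nat \<Rightarrow> 'a::field"
  assumes ind: "independent_rows m n R" and "m < n"
  shows "\<exists>R'. (\<forall>j<m. R' j = R j) \<and> independent_rows (Suc m) n R'"
proof -
  \<comment> \<open>If all \<open>n\<close> unit vectors were combinations of the \<open>m\<close>
    rows, the identity of size \<open>n\<close> would factor through \<open>m < n\<close>. So some
    unit vector lies outside the row space and can be appended.\<close>
  have "\<exists>k<n. \<nexists>c. \<forall>l<n. (\<Sum>j<m. c j * R j l) = of_bool (k = l)"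
  proof (rule ccontr)
    assume "\<not> ?thesis"
    then obtain B where "\<forall>k<n. \<forall>l<n. (\<Sum>j<m. B k j * R j l) = of_bool (k = l)"
      by metis
    then have "n \<le> m"
      by (intro right_inverse_imp_rows_le[where A = B and B = R]) auto
    with \<open>m < n\<close> show False by simp
  qed
  then obtain k where "k < n"
    and k: "\<nexists>c. \<forall>l<n. (\<Sum>j<m. c j * R j l) = of_bool (k = l)"
    by blast
  define R' where "R' = R(m := \<lambda>l. of_bool (k = l))"
  have "independent_rows (Suc m) n R'"
    unfolding independent_rows_def
  proof (intro allI impI)
    fix c j
    assume c: "\<forall>l<n. (\<Sum>j<Suc m. c j * R' j l) = 0" and "j < Suc m"
    have c': "(\<Sum>j<m. c j * R j l) + c m * of_bool (k = l) = 0" if "l < n" for l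
      using c that by (simp add: R'_def)
    have cm: "c m = 0"
    proof (rule ccontr)
      assume "c m \<noteq> 0"
      have "(\<Sum>j<m. (- c j / c m) * R j l) = of_bool (k = l)" if "l < n" for l
      proof -
        have "(\<Sum>j<m. (- c j / c m) * R j l) = - (\<Sum>j<m. c j * R j l) / c m"
          by (simp add: sum_divide_distrib sum_negf)
        also have "\<dots> = of_bool (k = l)"
          using c'[OF that] \<open>c m \<noteq> 0\<close>
            by (cases "k = l") (auto simp: add_eq_0_iff)
        finally show ?thesis .
      qed
      then show False
        using k by (auto dest!: spec[of _ "\<lambda>j. - c j / c m"])
    qed
    with c' have "\<forall>l<n. (\<Sum>j<m. c j * R j l) = 0" by simp
    with ind have "\<forall>j<m. c j = 0" by (auto simp: independent_rows_def)
    with cm \<open>j < Suc m\<close> show "c j = 0" by (auto simp: less_Suc_eq)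
  qed
  moreover have "\<forall>j<m. R' j = R j" by (simp add: R'_def)
  ultimately show ?thesis by blast
qed

lemma independent_rows_extend:
  fixes R :: "nat \<Rightarrow> nat \<Rightarrow> 'a::field"
  assumes "independent_rows m n R" "m \<le> n"
  shows "\<exists>R'. (\<forall>j<m. R' j = R j) \<and> independent_rows n n R'"
  using \<open>m \<le> n\<close> assms(1)
proof (induction arbitrary: R rule: inc_induct)
  case base
  then show ?case by blast
next
  case (step k)
  obtain R1 where R1: "\<forall>j<k. R1 j = R j" "independent_rows (Suc k) n R1"
    using independent_rows_extend1[OF step.prems step.hyps(2)] by blast
  obtain R2 where "\<forall>j<Suc k. R2 j = R1 j" "independent_rows n n R2"
    using step.IH[OF R1(2)] by blast
  with R1(1) show ?case by (intro exI[of _ R2]) auto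
qed

lemma independent_rows_inverse:
  fixes R :: "nat \<Rightarrow> nat \<Rightarrow> 'a::field"
  assumes "independent_rows n n R"
  shows "\<exists>P. \<forall>i<n. \<forall>j<n. (\<Sum>l<n. R i l * P l j) = of_bool (i = j)"
proof -
  \<comment> \<open>The transpose is taken so that a kernel vector of \<open>A\<close> is a linear
    relation between the rows of \<open>R\<close>.\<close>
  define A where "A = mat n n (\<lambda>(i, j). R j i)"
  have A: "A \<in> carrier_mat n n" by (simp add: A_def)
  have "det A \<noteq> 0"
  proof
    assume "det A = 0"
    then obtain v where v: "v \<in> carrier_vec n" "v \<noteq> 0\<^sub>v n" "A *\<^sub>v v = 0\<^sub>v n"
      using det_0_iff_vec_prod_zero_field[OF A] by blast
    have "(\<Sum>j<n. v $ j * R j l) = 0" if "l < n" for l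
    proof -
      have "(\<Sum>j<n. v $ j * R j l) = (A *\<^sub>v v) $ l"
        using that v(1)
        by (auto simp: A_def scalar_prod_def mult.commute lessThan_atLeast0 intro!: sum.cong)
      with v(3) that show ?thesis by simp
    qed
    with assms have "\<forall>j<n. v $ j = 0" by (auto simp: independent_rows_def)
    with v(1) have "v = 0\<^sub>v n" by (intro eq_vecI) auto
    with v(2) show False by simp
  qed
  from det_non_zero_imp_unit[OF A this, of "()"] obtain B
    where B: "B \<in> carrier_mat n n" "B * A = 1\<^sub>m n"
    by (auto simp: Units_def ring_mat_def)
  have "(\<Sum>l<n. R i l * B $$ (j, l)) = of_bool (i = j)" if "i < n" "j < n" for i j
  proof -
    have "(\<Sum>l<n. R i l * B $$ (j, l)) = (B * A) $$ (j, i)"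
      using that B(1)
      by (auto simp: A_def scalar_prod_def mult.commute lessThan_atLeast0 intro!: sum.cong)
    with B(2) that show ?thesis by auto
  qed
  then show ?thesis by (intro exI[of _ "\<lambda>l j. B $$ (j, l)"]) auto
qed

subsection \<open>Unit memory codes from a pair of parity check matrices\<close>

lemma dim_vec_generated_code:
  "v \<in> generated_code G \<Longrightarrow> dim_vec v = dim_col G"
  by (auto simp: generated_code_def)

lemma mult_transpose_index:
  fixes u :: "'a::comm_semiring_0 vec"
  assumes "l < dim_col G" "u \<in> carrier_vec (dim_row G)"
  shows "(transpose_mat G *\<^sub>v u) $ l = (\<Sum>t<dim_row G. u $ t * G $$ (t, l))"
  using assms by (auto simp: scalar_prod_def lessThan_atLeast0 mult.commute intro!: sum.cong)

lemma row_in_generated_code: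
  assumes "t < dim_row G"
  shows "row G t \<in> generated_code G"
proof -
  have "row G t = transpose_mat G *\<^sub>v unit_vec (dim_row G) t"
  proof (rule eq_vecI)
    fix l assume "l < dim_vec (transpose_mat G *\<^sub>v unit_vec (dim_row G) t)"
    then have l: "l < dim_col G" by simp
    have "(transpose_mat G *\<^sub>v unit_vec (dim_row G) t) $ l
        = (\<Sum>t'<dim_row G. unit_vec (dim_row G) t $ t' * G $$ (t', l))"
      using l by (intro mult_transpose_index) auto
    also have "\<dots> = (\<Sum>t'<dim_row G. if t' = t then G $$ (t', l) else 0)"
      using assms by (intro sum.cong) (auto simp: unit_vec_def)
    also have "\<dots> = G $$ (t, l)" using assms by simp
    finally show "row G t $ l = (transpose_mat G *\<^sub>v unit_vec (dim_row G) t) $ l"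
      using l assms by simp
  qed simp
  then show ?thesis by (auto simp: generated_code_def)
qed

text \<open>The weight counts pairs of a position and an exponent; keeping only the exponents
  \<open>t\<close> and \<open>T\<close> gives the bound.\<close>

lemma weight_ge_two_coeffs:
  assumes "t \<noteq> T"
  shows "card {l. l < dim_vec v \<and> coeff (v $ l) t \<noteq> 0} +
    card {l. l < dim_vec v \<and> coeff (v $ l) T \<noteq> 0} \<le> weight v"
proof -
  let ?S = "\<lambda>l. {m. coeff (v $ l) m \<noteq> 0}"
  have fin: "finite (?S l)" for l
    using finite_subset[of "?S l" "{..degree (v $ l)}"] by (auto intro: le_degree)
  have "of_bool (coeff (v $ l) t \<noteq> 0) + of_bool (coeff (v $ l) T \<noteq> 0) \<le> card (?S l)" for l
  proof -
    have "card ({t, T} \<inter> ?S l) \<le> card (?S l)"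
      by (intro card_mono fin) auto
    then show ?thesis using assms
      by (cases "coeff (v $ l) t = 0"; cases "coeff (v $ l) T = 0") auto
  qed
  then have "(\<Sum>l<dim_vec v. of_bool (coeff (v $ l) t \<noteq> 0) + of_bool (coeff (v $ l) T \<noteq> 0))
      \<le> weight v"
    unfolding weight_def by (intro sum_mono)
  then show ?thesis
    by (simp add: sum.distrib Collect_conj_eq Int_commute flip: lessThan_def)
qed

lemma weight_ge_coeff:
  "card {l. l < dim_vec v \<and> coeff (v $ l) t \<noteq> 0} \<le> weight v"
  using weight_ge_two_coeffs[of t "Suc t" v] by simp

lemma basic_matrixD:
  assumes "basic_matrix G"
  obtains H where "H \<in> carrier_mat (dim_col G) (dim_row G)"
    "\<And>i j. i < dim_row G \<Longrightarrow> j < dim_row G \<Longrightarrow>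
       (\<Sum>l<dim_col G. G $$ (i, l) * H $$ (l, j)) = of_bool (i = j)"
proof -
  from assms obtain H where H: "H \<in> carrier_mat (dim_col G) (dim_row G)"
    and GH: "G * H = 1\<^sub>m (dim_row G)"
    by (auto simp: basic_matrix_def inverts_mat_def)
  have "(\<Sum>l<dim_col G. G $$ (i, l) * H $$ (l, j)) = of_bool (i = j)"
    if "i < dim_row G" "j < dim_row G" for i j
  proof -
    have "(\<Sum>l<dim_col G. G $$ (i, l) * H $$ (l, j)) = (G * H) $$ (i, j)"
      using that H by (auto simp: scalar_prod_def lessThan_atLeast0 intro!: sum.cong)
    with GH that show ?thesis by simp
  qed
  with H that show ?thesis by blast
qed

lemma degree_le_row_degree:
  "l < dim_col G \<Longrightarrow> degree (G $$ (i, l)) \<le> row_degree G i"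
  unfolding row_degree_def by (intro Max_ge) auto

text \<open>In the coordinates given by the rows of \<open>Q\<close>, the code below consists of the words whose first
  \<open>s\<close> coordinates are \<open>D\<close> times the coordinates \<open>r, \<dots>, r + s - 1\<close>, and whose coordinates
  \<open>s, \<dots>, r - 1\<close> vanish: rows \<open>0, \<dots>, r - 1\<close> form \<open>H\<^sub>0\<close> and rows \<open>r, \<dots>, r + s - 1\<close> form \<open>H\<^sub>1\<close>.\<close>
locale unit_memory_code =
  fixes n r s :: nat and Q P :: "nat \<Rightarrow> nat \<Rightarrow> 'a::field"
  assumes QP: "a < n \<Longrightarrow> b < n \<Longrightarrow> (\<Sum>l<n. Q a l * P l b) = of_bool (a = b)"
    and s_pos: "0 < s" and s_le: "s \<le> r" and rs_le: "r + s \<le> n"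
begin

text \<open>Column \<open>b\<close> of \<open>P\<close> is the word whose coordinate
  \<open>b\<close> is 1 and whose other coordinates are 0. So row \<open>t\<close> has coordinate 1
  at \<open>r + t\<close> and, for \<open>t < s\<close>, coordinate D at \<open>t\<close>, as the
  relations between the coordinates demand.\<close>

definition G :: "'a poly mat" where
  "G = mat (n - r) n (\<lambda>(t, l). [:P l (r + t), if t < s then P l t else 0:])"

definition syndrome :: "nat \<Rightarrow> 'a poly vec \<Rightarrow> nat \<Rightarrow> 'a" where
  "syndrome a v m = (\<Sum>l<n. Q a l * coeff (v $ l) m)"

lemma dim_G [simp]: "dim_row G = n - r" "dim_col G = n" "G \<in> carrier_mat (n - r) n"
  by (simp_all add: G_def)

lemma PQ: "a < n \<Longrightarrow> b < n \<Longrightarrow> (\<Sum>l<n. P a l * Q l b) = of_bool (a = b)"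
  by (rule inverse_rows_commute[of n Q P]) (auto simp: QP)

section \<open>Coordinates of the codewords\<close>

lemma coeff_eq_syndromes:
  assumes "l < n"
  shows "coeff (v $ l) m = (\<Sum>a<n. P l a * syndrome a v m)"
proof -
  have "(\<Sum>a<n. P l a * syndrome a v m)
      = (\<Sum>a<n. \<Sum>k<n. (P l a * Q a k) * coeff (v $ k) m)"
    by (simp add: syndrome_def sum_distrib_left mult.assoc)
  also have "\<dots> = (\<Sum>k<n. (\<Sum>a<n. P l a * Q a k) * coeff (v $ k) m)"
    by (subst sum.swap) (simp add: sum_distrib_right)
  also have "\<dots> = (\<Sum>k<n. if k = l then coeff (v $ k) m else 0)"
    using assms by (intro sum.cong) (auto simp: PQ)
  also have "\<dots> = coeff (v $ l) m" using assms by simp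
  finally show ?thesis by simp
qed

lemma coeff_G_mult:
  assumes "u \<in> carrier_vec (n - r)" "l < n"
  shows "coeff ((transpose_mat G *\<^sub>v u) $ l) m =
    (\<Sum>t<n-r. P l (r + t) * coeff (u $ t) m + of_bool (t < s) * P l t * coeff (pCons 0 (u $ t)) m)"
proof -
  have "(transpose_mat G *\<^sub>v u) $ l = (\<Sum>t<n-r. u $ t * G $$ (t, l))"
    using assms by (subst mult_transpose_index) auto
  also have "\<dots> = (\<Sum>t<n-r. smult (P l (r + t)) (u $ t) +
      smult (of_bool (t < s) * P l t) (pCons 0 (u $ t)))"
    using assms(2) by (intro sum.cong) (auto simp: G_def mult.commute)
  finally show ?thesis by (cases m) (simp_all add: coeff_sum)
qed

text \<open>As \<open>Q\<close> and \<open>P\<close> are inverse to each other, at most one term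
  survives: the message itself from index \<open>r\<close> on, D times the message below
  \<open>s\<close>, and nothing in between. Writing the shift as \<open>pCons 0\<close> covers
  \<open>m = 0\<close> too.\<close>

lemma syndrome_G_mult:
  assumes u: "u \<in> carrier_vec (n - r)" and a: "a < n"
  shows "syndrome a (transpose_mat G *\<^sub>v u) m =
    (if r \<le> a then coeff (u $ (a - r)) m
     else if a < s then coeff (pCons 0 (u $ a)) m else 0)"
proof -
  have "syndrome a (transpose_mat G *\<^sub>v u) m = (\<Sum>l<n. \<Sum>t<n-r.
      Q a l * P l (r + t) * coeff (u $ t) m +
      (Q a l * P l t) * (of_bool (t < s) * coeff (pCons 0 (u $ t)) m))"
    unfolding syndrome_def
    by (intro sum.cong) (auto simp: coeff_G_mult[OF u] sum_distrib_left algebra_simps simp del: index_mult_mat_vec)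
  also have "\<dots> = (\<Sum>t<n-r. (\<Sum>l<n. Q a l * P l (r + t)) * coeff (u $ t) m +
      (\<Sum>l<n. Q a l * P l t) * (of_bool (t < s) * coeff (pCons 0 (u $ t)) m))"
    by (subst sum.swap) (simp add: sum.distrib sum_distrib_right)
  also have "\<dots> = (\<Sum>t<n-r. of_bool (a = r + t) * coeff (u $ t) m +
      of_bool (a = t) * (of_bool (t < s) * coeff (pCons 0 (u $ t)) m))"
    using a by (intro sum.cong) (auto simp: QP)
  also have "\<dots> = (\<Sum>t<n-r. if t = a - r then (if r \<le> a then coeff (u $ t) m else 0) else 0) +
      (\<Sum>t<n-r. if t = a then (if t < s then coeff (pCons 0 (u $ t)) m else 0) else 0)"
    unfolding sum.distrib by (intro arg_cong2[of _ _ _ _ "(+)"] sum.cong) auto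
  also have "\<dots> = (if r \<le> a then coeff (u $ (a - r)) m
     else if a < s then coeff (pCons 0 (u $ a)) m else 0)"
    using a s_le rs_le by (cases "r \<le> a") auto
  finally show ?thesis .
qed

context
  fixes v :: "'a poly vec"
  assumes v: "v \<in> generated_code G"
begin

lemma syndrome_0: "a < r \<Longrightarrow> syndrome a v 0 = 0"
  using v rs_le by (auto simp: generated_code_def syndrome_G_mult)

text \<open>The factor D in the defining relation shifts exponents by one, which ties each
  coefficient of a codeword to its neighbour.\<close>

lemma syndrome_Suc: "a < s \<Longrightarrow> syndrome a v (Suc m) = syndrome (r + a) v m"
  using v rs_le s_le by (auto simp: generated_code_def syndrome_G_mult)

lemma syndrome_eq_0: "s \<le> a \<Longrightarrow> a < r \<Longrightarrow> syndrome a v m = 0"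
  using v rs_le by (auto simp: generated_code_def syndrome_G_mult)

lemma dim_vec_code: "dim_vec v = n"
  using dim_vec_generated_code[OF v] by simp

end

section \<open>Basicness, degree and memory of the generator matrix\<close>

lemma basic_matrix_G: "basic_matrix G"
proof -
  \<comment> \<open>The message is the list of coordinates from \<open>r\<close> on, so the
    corresponding rows of \<open>Q\<close> give a constant right inverse. The D parts of
    \<open>G\<close> only involve coordinates below \<open>s \<le> r\<close> and are invisible to
    it.\<close>
  define H :: "'a poly mat" where "H = mat n (n - r) (\<lambda>(l, t). [:Q (r + t) l:])"
  have "G * H = 1\<^sub>m (n - r)"
  proof (rule eq_matI)
    fix t t' assume "t < dim_row (1\<^sub>m (n - r) :: 'a poly mat)" "t' < dim_col (1\<^sub>m (n - r) :: 'a poly mat)"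
    then have t: "t < n - r" "t' < n - r" by auto
    have "(G * H) $$ (t, t') = (\<Sum>l<n. G $$ (t, l) * H $$ (l, t'))"
      using t by (auto simp: scalar_prod_def lessThan_atLeast0 H_def intro!: sum.cong)
    also have "\<dots> = (\<Sum>l<n. [:Q (r + t') l * P l (r + t):] +
        pCons 0 [:of_bool (t < s) * (Q (r + t') l * P l t):])"
      using t by (intro sum.cong) (auto simp: G_def H_def)
    also have "\<dots> = [:\<Sum>l<n. Q (r + t') l * P l (r + t):] +
        pCons 0 [:of_bool (t < s) * (\<Sum>l<n. Q (r + t') l * P l t):]"
      by (intro poly_eqI) (simp add: coeff_sum sum.distrib sum_distrib_left coeff_pCons split: nat.split)
    also have "(\<Sum>l<n. Q (r + t') l * P l (r + t)) = of_bool (t' = t)"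
      using t by (subst QP) auto
    also have "of_bool (t < s) * (\<Sum>l<n. Q (r + t') l * P l t) = 0"
      using t s_le rs_le by (cases "t < s") (auto simp: QP)
    finally show "(G * H) $$ (t, t') = 1\<^sub>m (n - r) $$ (t, t')"
      using t by (auto simp: one_pCons)
  qed (auto simp: H_def)
  then show ?thesis
    by (auto simp: basic_matrix_def inverts_mat_def H_def intro!: bexI[of _ H])
qed

lemma P_column_nonzero:
  assumes "b < n"
  shows "\<exists>l<n. P l b \<noteq> 0"
proof (rule ccontr)
  assume "\<not> ?thesis"
  then have "(\<Sum>l<n. Q b l * P l b) = 0" by (intro sum.neutral) auto
  with QP[of b b] assms show False by simp
qed

lemma row_degree_G:
  assumes "t < n - r"
  shows "row_degree G t = of_bool (t < s)"
proof (cases "t < s")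
  case True
  obtain l where l: "l < n" "P l t \<noteq> 0"
    using P_column_nonzero[of t] assms by (meson diff_le_self order_less_le_trans)
  have "degree (G $$ (t, l)) \<le> row_degree G t"
    using l by (intro degree_le_row_degree) simp
  moreover have "degree (G $$ (t, l)) = 1"
    using l assms True by (simp add: G_def)
  moreover have "row_degree G t \<le> 1"
    unfolding row_degree_def using assms l
    by (intro Max.boundedI) (auto simp: G_def)
  ultimately show ?thesis using True by simp
next
  case False
  have "0 < n" using assms by simp
  with False assms show ?thesis
    unfolding row_degree_def
    by (auto simp: G_def image_def intro!: Max_eqI)
qed

lemma overall_constraint_length_G: "overall_constraint_length G = s"
proof -
  have "overall_constraint_length G = (\<Sum>t<n-r. of_bool (t < s))"
    by (simp add: overall_constraint_length_def row_degree_G)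
  also have "\<dots> = card {t. t < n - r \<and> t < s}"
    by (simp add: Collect_conj_eq lessThan_def)
  also have "{t. t < n - r \<and> t < s} = {..<s}"
    using rs_le by auto
  finally show ?thesis by simp
qed

lemma memory_G: "memory G = 1"
proof -
  have "row_degree G ` {..<n - r} = (\<lambda>t. of_bool (t < s)) ` {..<n - r}"
    by (intro image_cong) (auto simp: row_degree_G)
  moreover have "Max \<dots> = (1::nat)"
    using s_pos rs_le by (intro Max_eqI) (auto simp: image_def intro!: bexI[of _ 0])
  ultimately show ?thesis by (simp add: memory_def)
qed

text \<open>The constant words of the code form a space of dimension \<open>n - r - s\<close>, so at least
  \<open>s\<close> of the at least \<open>n - r\<close> rows of any basic generator matrix are nonconstant.\<close>
lemma overall_constraint_length_ge:
  assumes basic: "basic_matrix G'" and gen: "generated_code G' = generated_code G"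
  shows "s \<le> overall_constraint_length G'"
proof -
  define k where "k = dim_row G'"
  \<comment> \<open>Equal codes have words of equal length; the zero word of \<open>G'\<close> shows
    it.\<close>
  have n: "dim_col G' = n"
  proof -
    have "transpose_mat G' *\<^sub>v 0\<^sub>v k \<in> generated_code G"
      unfolding gen[symmetric] by (auto simp: generated_code_def k_def)
    from dim_vec_generated_code[OF this] show ?thesis by simp
  qed
  obtain H where H: "\<And>i j. i < k \<Longrightarrow> j < k \<Longrightarrow>
      (\<Sum>l<n. G' $$ (i, l) * H $$ (l, j)) = of_bool (i = j)"
    using basic_matrixD[OF basic] unfolding k_def n by blast
  \<comment> \<open>Setting D = 0 turns the polynomial right inverse into one over the
    field.\<close>
  have H0: "(\<Sum>l<n. coeff (G' $$ (i, l)) 0 * coeff (H $$ (l, j)) 0) = of_bool (i = j)"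
    if "i < k" "j < k" for i j
    using arg_cong[OF H[OF that], of "\<lambda>p. coeff p 0"]
    by (cases "i = j") (simp_all add: coeff_sum coeff_mult_0)
  have "n - r \<le> k"
  proof -
    have "\<exists>u\<in>carrier_vec k. row G t = transpose_mat G' *\<^sub>v u" if "t < n - r" for t
    proof -
      have "row G t \<in> generated_code G'"
        unfolding gen using that by (intro row_in_generated_code) simp
      then show ?thesis by (auto simp: generated_code_def k_def)
    qed
    then obtain U where U: "\<And>t. t < n - r \<Longrightarrow> U t \<in> carrier_vec k"
        "\<And>t. t < n - r \<Longrightarrow> row G t = transpose_mat G' *\<^sub>v U t"
      by metis
    have *: "P l (r + t) = (\<Sum>j<k. coeff (U t $ j) 0 * coeff (G' $$ (j, l)) 0)"
      if "t < n - r" "l < n" for t l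
    proof -
      have "P l (r + t) = coeff (row G t $ l) 0"
        using that by (simp add: G_def)
      also have "row G t $ l = (\<Sum>j<k. U t $ j * G' $$ (j, l))"
        using that n U(1)[OF that(1)] unfolding U(2)[OF that(1)] k_def
        by (intro mult_transpose_index) auto
      finally show ?thesis by (simp add: coeff_sum coeff_mult_0)
    qed
    \<comment> \<open>The rows of \<open>G\<close> at D = 0 are combinations of the \<open>k\<close>
      rows of \<open>G'\<close> at D = 0. Pairing them with the rows \<open>r + t'\<close> of
      \<open>Q\<close> factors the identity of size \<open>n - r\<close> through
      \<open>k\<close>.\<close>
    have "(\<Sum>j<k. coeff (U t $ j) 0 * (\<Sum>l<n. coeff (G' $$ (j, l)) 0 * Q (r + t') l))
        = of_bool (t = t')" if "t < n - r" "t' < n - r" for t t'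
    proof -
      have "(\<Sum>j<k. coeff (U t $ j) 0 * (\<Sum>l<n. coeff (G' $$ (j, l)) 0 * Q (r + t') l))
          = (\<Sum>l<n. \<Sum>j<k. coeff (U t $ j) 0 * (coeff (G' $$ (j, l)) 0 * Q (r + t') l))"
        by (subst sum.swap) (simp add: sum_distrib_left)
      also have "\<dots> = (\<Sum>l<n. Q (r + t') l * P l (r + t))"
        using * that(1) by (simp add: sum_distrib_left sum_distrib_right mult_ac)
      also have "\<dots> = of_bool (t = t')" using that by (subst QP) auto
      finally show ?thesis .
    qed
    then show ?thesis by (rule right_inverse_imp_rows_le)
  qed
  moreover
  \<comment> \<open>The constant rows of \<open>G'\<close>.\<close>
  define J where "J = {j. j < k \<and> row_degree G' j = 0}"
  have "card J \<le> n - r - s"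
  proof -
    have "finite J" by (simp add: J_def)
    then obtain f where f: "bij_betw f {..<card J} J"
      using ex_bij_betw_nat_finite by (metis atLeast0LessThan)
    have fJ: "f x \<in> J" if "x < card J" for x
      using f that by (auto simp: bij_betw_def)
    \<comment> \<open>A constant word has no coefficient at D, so \<open>syndrome_Suc\<close> also
      kills its coordinates \<open>r, ..., r + s - 1\<close>.\<close>
    have syn: "syndrome a (row G' j) 0 = 0" if j: "j \<in> J" and a: "a < r + s" for j a
    proof -
      have jk: "j < k" and deg: "row_degree G' j = 0" using j by (auto simp: J_def)
      have row: "row G' j \<in> generated_code G"
        unfolding gen[symmetric] using jk by (intro row_in_generated_code) (simp add: k_def)
      have "coeff (row G' j $ l) 1 = 0" if "l < n" for l
        using degree_le_row_degree[of l G' j] that n deg jk by (simp add: k_def coeff_eq_0)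
      then have "syndrome b (row G' j) 1 = 0" for b by (simp add: syndrome_def)
      then show ?thesis
        using syndrome_0[OF row, of a] syndrome_Suc[OF row, of "a - r" 0] a
        by (cases "a < r") auto
    qed
    \<comment> \<open>Only \<open>n - r - s\<close> coordinates remain for a constant row, and
      \<open>H\<close> at D = 0 is dual to these rows, so the identity of size \<open>card J\<close>
      factors through \<open>n - r - s\<close>.\<close>
    have "(\<Sum>a<n-r-s. syndrome (r + s + a) (row G' (f x)) 0 *
        (\<Sum>l<n. P l (r + s + a) * coeff (H $$ (l, f y)) 0)) = of_bool (x = y)"
      if xy: "x < card J" "y < card J" for x y
    proof -
      have fx: "f x < k" "f y < k" using fJ xy by (auto simp: J_def)
      have G'_eq: "coeff (G' $$ (f x, l)) 0 =
          (\<Sum>a<n-r-s. P l (r + s + a) * syndrome (r + s + a) (row G' (f x)) 0)" if "l < n" for l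
      proof -
        have "coeff (G' $$ (f x, l)) 0 = coeff (row G' (f x) $ l) 0"
          using that fx n by (simp add: k_def)
        also have "\<dots> = (\<Sum>a<n. P l a * syndrome a (row G' (f x)) 0)"
          by (rule coeff_eq_syndromes) fact
        also have "\<dots> = (\<Sum>a\<in>{r+s..<n}. P l a * syndrome a (row G' (f x)) 0)"
          using syn[OF fJ[OF xy(1)]] by (intro sum.mono_neutral_right) auto
        also have "\<dots> = (\<Sum>a<n-r-s. P l (r + s + a) * syndrome (r + s + a) (row G' (f x)) 0)"
          using rs_le
          by (intro sum.reindex_bij_witness[of _ "\<lambda>a. r + s + a" "\<lambda>a. a - (r + s)"]) auto
        finally show ?thesis .
      qed
      have "of_bool (x = y) = (of_bool (f x = f y) :: 'a)"
        using f xy by (auto simp: bij_betw_def inj_on_def)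
      also have "\<dots> = (\<Sum>l<n. coeff (G' $$ (f x, l)) 0 * coeff (H $$ (l, f y)) 0)"
        using H0[OF fx] by simp
      also have "\<dots> = (\<Sum>l<n. \<Sum>a<n-r-s. syndrome (r + s + a) (row G' (f x)) 0 *
          (P l (r + s + a) * coeff (H $$ (l, f y)) 0))"
        by (intro sum.cong refl) (simp add: G'_eq sum_distrib_right, simp add: mult_ac)
      also have "\<dots> = (\<Sum>a<n-r-s. syndrome (r + s + a) (row G' (f x)) 0 *
          (\<Sum>l<n. P l (r + s + a) * coeff (H $$ (l, f y)) 0))"
        by (subst sum.swap) (simp add: sum_distrib_left)
      finally show ?thesis by simp
    qed
    then show ?thesis by (rule right_inverse_imp_rows_le)
  qed
  \<comment> \<open>Every row outside \<open>J\<close> contributes at least 1 to the overall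
    constraint length.\<close>
  moreover have "k - card J \<le> overall_constraint_length G'"
  proof -
    have "k - card J = card ({..<k} - J)"
      by (subst card_Diff_subset) (auto simp: J_def)
    also have "\<dots> = (\<Sum>j\<in>{..<k} - J. 1)" by simp
    also have "\<dots> \<le> (\<Sum>j\<in>{..<k} - J. row_degree G' j)"
      by (intro sum_mono) (auto simp: J_def)
    also have "\<dots> \<le> overall_constraint_length G'"
      unfolding overall_constraint_length_def k_def by (intro sum_mono2) auto
    finally show ?thesis .
  qed
  ultimately show ?thesis using rs_le by linarith
qed

section \<open>Parameters and free distance of the code\<close>

lemma convolutional_code_G: "convolutional_code n (n - r) s 1 (generated_code G)"
  unfolding convolutional_code_def reduced_basic_matrix_def
  using basic_matrix_G overall_constraint_length_G overall_constraint_length_ge memory_G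
  by (intro bexI[of _ G]) auto

text \<open>With \<open>v\<^sub>m\<close> the coefficient vector of a codeword at exponent m, the
  first \<open>s\<close> rows of \<open>H\<^sub>0\<close> applied to \<open>v\<^sub>m\<close> equal
  \<open>H\<^sub>1\<close> applied to the preceding coefficient. At the lowest exponent there is no
  predecessor and at the highest no successor, which puts these two coefficients into the respective
  kernels.\<close>

lemma free_distance_G_ge:
  assumes d0: "\<And>c. (\<And>a. a < r \<Longrightarrow> (\<Sum>l<n. Q a l * c l) = 0) \<Longrightarrow> \<exists>l<n. c l \<noteq> 0 \<Longrightarrow>
      d0 \<le> card {l. l < n \<and> c l \<noteq> 0}"
    and d1: "\<And>c. (\<And>a. r \<le> a \<Longrightarrow> a < r + s \<Longrightarrow> (\<Sum>l<n. Q a l * c l) = 0) \<Longrightarrow> \<exists>l<n. c l \<noteq> 0 \<Longrightarrow>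
      d1 \<le> card {l. l < n \<and> c l \<noteq> 0}"
    and d: "\<And>c. (\<And>a. a < r + s \<Longrightarrow> (\<Sum>l<n. Q a l * c l) = 0) \<Longrightarrow> \<exists>l<n. c l \<noteq> 0 \<Longrightarrow>
      d \<le> card {l. l < n \<and> c l \<noteq> 0}"
  shows "min (d0 + d1) d \<le> free_distance (generated_code G)"
  unfolding free_distance_def
proof (rule cInf_greatest)
  \<comment> \<open>The infimum of the empty set is 0 in \<open>nat\<close>, so a nonzero codeword
    has to be exhibited. In row 0 the coefficients at D form column 0 of \<open>P\<close>, which is
    nonzero.\<close>
  have "row G 0 \<in> generated_code G"
    using s_pos rs_le by (intro row_in_generated_code) auto
  moreover have "row G 0 \<noteq> 0\<^sub>v (dim_vec (row G 0))"
  proof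
    assume *: "row G 0 = 0\<^sub>v (dim_vec (row G 0))"
    obtain l where l: "l < n" "P l 0 \<noteq> 0"
      using P_column_nonzero[of 0] s_pos rs_le by auto
    have "G $$ (0, l) = row G 0 $ l"
      using l s_pos rs_le by simp
    also have "\<dots> = 0" using l by (subst *) simp
    finally show False using l s_pos rs_le by (simp add: G_def)
  qed
  ultimately show "{weight v |v. v \<in> generated_code G \<and> v \<noteq> 0\<^sub>v (dim_vec v)} \<noteq> {}"
    by blast
next
  fix w assume "w \<in> {weight v |v. v \<in> generated_code G \<and> v \<noteq> 0\<^sub>v (dim_vec v)}"
  then obtain v where w: "w = weight v" and v: "v \<in> generated_code G" and "v \<noteq> 0\<^sub>v (dim_vec v)"
    by blast
  have dim: "dim_vec v = n" by (rule dim_vec_code[OF v])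
  define N where "N = {m. \<exists>l<n. coeff (v $ l) m \<noteq> 0}"
  have "finite N"
  proof -
    have "N \<subseteq> (\<Union>l<n. {..degree (v $ l)})"
      unfolding N_def by (auto intro: le_degree)
    then show ?thesis by (rule finite_subset) auto
  qed
  have "N \<noteq> {}"
  proof
    assume "N = {}"
    then have "coeff (v $ l) m = 0" if "l < n" for l m
      using that by (auto simp: N_def)
    then have "v = 0\<^sub>v (dim_vec v)"
      using dim by (intro eq_vecI) (auto intro!: poly_eqI)
    with \<open>v \<noteq> 0\<^sub>v (dim_vec v)\<close> show False by blast
  qed
  have syn_notin: "syndrome a v m = 0" if "m \<notin> N" for a m
    unfolding syndrome_def using that by (intro sum.neutral) (auto simp: N_def)
  define t where "t = Min N"
  define T where "T = Max N"
  have t: "t \<in> N" and T: "T \<in> N"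
    using \<open>finite N\<close> \<open>N \<noteq> {}\<close> by (auto simp: t_def T_def)
  have low: "syndrome a v t = 0" if "a < r" for a
  proof (cases t)
    case 0
    with syndrome_0[OF v that] show ?thesis by simp
  next
    case (Suc m)
    have "m \<notin> N" using Min_le[OF \<open>finite N\<close>, of m] Suc by (auto simp: t_def)
    then show ?thesis
      using syndrome_Suc[OF v, of a m] syndrome_eq_0[OF v, of a t] syn_notin[of m "r + a"] that Suc
      by (cases "a < s") auto
  qed
  have high: "syndrome a v T = 0" if "r \<le> a" "a < r + s" for a
  proof -
    have "Suc T \<notin> N" using Max_ge[OF \<open>finite N\<close>, of "Suc T"] by (auto simp: T_def)
    then show ?thesis
      using syndrome_Suc[OF v, of "a - r" T] syn_notin[of "Suc T" "a - r"] that by auto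
  qed
  show "min (d0 + d1) d \<le> w"
  proof (cases "t = T")
    case True
    have "d \<le> card {l. l < n \<and> coeff (v $ l) t \<noteq> 0}"
      using t low high True by (intro d) (auto simp: N_def syndrome_def not_less[symmetric])
    also have "\<dots> \<le> w"
      using weight_ge_coeff[of v t] by (simp add: w dim)
    finally show ?thesis by simp
  next
    case False
    have "d0 \<le> card {l. l < n \<and> coeff (v $ l) t \<noteq> 0}"
      using t low by (intro d0) (auto simp: N_def syndrome_def)
    moreover have "d1 \<le> card {l. l < n \<and> coeff (v $ l) T \<noteq> 0}"
      using T high by (intro d1) (auto simp: N_def syndrome_def)
    ultimately show ?thesis
      using weight_ge_two_coeffs[OF False, of v] by (simp add: w dim)
  qed
qed

end

subsection \<open>The BCH bound and the quadratic extension field\<close>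

text \<open>In place of a Vandermonde determinant: if the support had at most
  \<open>\<delta>\<close> elements, the polynomial \<open>f\<close> vanishing on all of them but
  \<open>k\<close> would have degree below \<open>\<delta>\<close>. The combination of the vanishing
  sums with the coefficients of \<open>f\<close> then leaves a single nonzero term at
  \<open>k\<close>.\<close>

lemma bch_bound:
  fixes \<alpha> c :: "'i \<Rightarrow> 'b::field"
  assumes "finite A" and inj: "inj_on \<alpha> A" and nz: "\<And>l. l \<in> A \<Longrightarrow> \<alpha> l \<noteq> 0"
    and zeros: "\<And>j. j < \<delta> \<Longrightarrow> (\<Sum>l\<in>A. c l * \<alpha> l ^ (b + j)) = 0"
    and "\<exists>l\<in>A. c l \<noteq> 0"
  shows "\<delta> < card {l \<in> A. c l \<noteq> 0}"
proof (rule ccontr)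
  define W where "W = {l \<in> A. c l \<noteq> 0}"
  assume "\<not> ?thesis"
  then have card: "card W \<le> \<delta>" by (simp add: W_def)
  have "finite W" using \<open>finite A\<close> by (simp add: W_def)
  obtain k where k: "k \<in> W" using assms(5) by (auto simp: W_def)
  define f where "f = (\<Prod>l\<in>W - {k}. [:- \<alpha> l, 1:])"
  have "degree f = card (W - {k})"
    unfolding f_def by (subst degree_prod_eq_sum_degree) auto
  then have deg: "degree f < \<delta>"
    using card k \<open>finite W\<close> card_gt_0_iff[of W] by auto
  have "(\<Sum>l\<in>A. c l * \<alpha> l ^ b * poly f (\<alpha> l))
      = (\<Sum>l\<in>A. \<Sum>j\<le>degree f. coeff f j * (c l * \<alpha> l ^ (b + j)))"
    by (simp add: poly_altdef sum_distrib_left power_add mult_ac)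
  also have "\<dots> = (\<Sum>j\<le>degree f. coeff f j * (\<Sum>l\<in>A. c l * \<alpha> l ^ (b + j)))"
    by (subst sum.swap) (simp add: sum_distrib_left)
  also have "\<dots> = 0" using deg zeros by simp
  finally have "(\<Sum>l\<in>A. c l * \<alpha> l ^ b * poly f (\<alpha> l)) = 0" .
  moreover have "(\<Sum>l\<in>A. c l * \<alpha> l ^ b * poly f (\<alpha> l))
      = (\<Sum>l\<in>{k}. c l * \<alpha> l ^ b * poly f (\<alpha> l))"
    using k \<open>finite A\<close> \<open>finite W\<close>
    by (intro sum.mono_neutral_right) (auto simp: f_def poly_prod W_def)
  moreover have "poly f (\<alpha> k) \<noteq> 0"
    using inj k \<open>finite W\<close> by (auto simp: f_def poly_prod W_def inj_on_def)
  ultimately show False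
    using k nz by (auto simp: W_def)
qed

text \<open>A repeated linear factor would give a common root with the derivative, so the multiset
  of roots is a set.\<close>

lemma card_roots_eq_degree:
  fixes p :: "'b::alg_closed_field poly"
  assumes "p \<noteq> 0" and simple: "\<And>x. poly p x = 0 \<Longrightarrow> poly (pderiv p) x \<noteq> 0"
  shows "card {x. poly p x = 0} = degree p"
proof -
  obtain A where A: "size A = degree p"
      "p = smult (lead_coeff p) (\<Prod>x\<in>#A. [:- x, 1:])"
    using alg_closed_imp_factorization[OF \<open>p \<noteq> 0\<close>] by blast
  have roots: "{x. poly p x = 0} = set_mset A"
    using \<open>p \<noteq> 0\<close> by (subst A(2)) (auto simp: poly_prod_mset)
  have "count A x = 1" if "x \<in># A" for x
  proof (rule ccontr)
    assume "count A x \<noteq> 1"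
    with that have "2 \<le> count A x"
      by (metis One_nat_def Suc_1 count_eq_zero_iff le_SucE less_one not_less not_less_eq_eq)
    then have "{#x, x#} \<subseteq># A"
      by (auto simp: subseteq_mset_def)
    then obtain B where "A = {#x, x#} + B"
      by (auto simp: subset_mset.le_iff_add)
    then have "p = [:- x, 1:] * ([:- x, 1:] * smult (lead_coeff p) (\<Prod>x\<in>#B. [:- x, 1:]))"
      by (subst A(2)) (simp add: mult_ac)
    then obtain r where "p = [:- x, 1:] * ([:- x, 1:] * r)" by blast
    then have "poly p x = 0" "poly (pderiv p) x = 0"
      by (simp_all only: pderiv_mult) simp_all
    with simple show False by blast
  qed
  then have "size A = card (set_mset A)"
    by (simp add: size_multiset_overloaded_eq)
  with A(1) roots show ?thesis by simp
qed

text \<open>Multiplication by a nonzero \<open>x\<close> permutes the nonzero elements; comparing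
  their products gives Fermat's identity.\<close>

lemma power_card_eq_self:
  fixes x :: "'a::{field,finite}"
  shows "x ^ CARD('a) = x"
proof (cases "x = 0")
  case False
  let ?U = "UNIV - {0 :: 'a}"
  have "(\<Prod>y\<in>?U. y) = (\<Prod>y\<in>?U. x * y)"
    by (rule prod.reindex_bij_witness[of _ "\<lambda>y. x * y" "\<lambda>y. y / x"]) (use False in auto)
  also have "\<dots> = x ^ (CARD('a) - 1) * (\<Prod>y\<in>?U. y)"
    by (simp add: prod.distrib card_Diff_singleton)
  finally have "x ^ (CARD('a) - 1) = 1" by simp
  moreover have "CARD('a) = Suc (CARD('a) - 1)"
    using finite_UNIV_card_ge_0[where 'a = 'a] by simp
  ultimately show ?thesis
    by (metis mult.right_neutral power_Suc)
qed simp

text \<open>Exhibits the \<open>q\<close>-th power as an iterate of the Frobenius map, so that it is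
  additive.\<close>

lemma card_eq_CHAR_power:
  assumes "primepow CARD('a::{field,finite})"
  obtains e where "prime CHAR('a)" "CARD('a) = CHAR('a) ^ e"
proof -
  obtain p e where pe: "prime p" "CARD('a) = p ^ e"
    using assms by (auto simp: primepow_def)
  have prime: "prime CHAR('a)"
    by (intro prime_CHAR_semidom finite_imp_CHAR_pos) simp
  have "CHAR('a) dvd p ^ e"
    using CHAR_dvd_CARD[where 'a = 'a] pe by simp
  with prime pe have "CHAR('a) = p"
    by (metis prime_dvd_power primes_dvd_imp_eq)
  with that prime pe show ?thesis by blast
qed

section \<open>The field with q^2 elements inside the algebraic closure\<close>

locale quadratic_extension =
  fixes ty :: "'a::{field,finite} itself" and q :: nat
  assumes primepow: "primepow q" and card_eq: "CARD('a) = q"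
begin

lemma frobenius_sum:
  fixes f :: "'i \<Rightarrow> 'a alg_closure"
  shows "(\<Sum>x\<in>A. f x) ^ q = (\<Sum>x\<in>A. f x ^ q)"
proof -
  obtain e where "prime CHAR('a)" "q = CHAR('a) ^ e"
    using card_eq_CHAR_power[where 'a = 'a] primepow card_eq by metis
  then show ?thesis by (intro freshmans_dream_sum') auto
qed

lemma frobenius_add: "(x + y) ^ q = x ^ q + (y ^ q :: 'a alg_closure)"
proof -
  obtain e where "prime CHAR('a)" "q = CHAR('a) ^ e"
    using card_eq_CHAR_power[where 'a = 'a] primepow card_eq by metis
  then show ?thesis by (intro freshmans_dream') auto
qed

lemma q_gt_1: "1 < q"
  using primepow primepow_gt_Suc_0[of q] by simp

lemma of_nat_q: "of_nat q = (0 :: 'a alg_closure)"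
  using CHAR_dvd_CARD[where 'a = 'a] card_eq of_nat_eq_0_iff_char_dvd[where 'a = "'a alg_closure"]
  by simp

lemma to_ac_power_q: "to_ac (x :: 'a) ^ q = to_ac x"
  using power_card_eq_self[of x] card_eq by (metis to_ac_power)

text \<open>The \<open>q\<close> elements of the base field are fixed, and X^q - X has no more than
  \<open>q\<close> roots.\<close>

lemma range_to_ac: "range (to_ac :: 'a \<Rightarrow> _) = {x. x ^ q = x}"
proof (rule card_seteq[symmetric, THEN sym])
  define p :: "'a alg_closure poly" where "p = monom 1 q - monom 1 1"
  have p: "degree p = q"
    unfolding p_def diff_conv_add_uminus using q_gt_1
    by (subst degree_add_eq_left) (auto simp: degree_monom_eq)
  then have "p \<noteq> 0" using q_gt_1 by auto
  have roots: "{x. poly p x = 0} = {x. x ^ q = x}"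
    by (auto simp: p_def poly_monom)
  show "finite {x :: 'a alg_closure. x ^ q = x}"
    using poly_roots_finite[OF \<open>p \<noteq> 0\<close>] by (simp add: roots)
  show "range (to_ac :: 'a \<Rightarrow> _) \<subseteq> {x. x ^ q = x}"
    using to_ac_power_q by auto
  show "card {x :: 'a alg_closure. x ^ q = x} \<le> card (range (to_ac :: 'a \<Rightarrow> _))"
    using card_poly_roots_bound[OF \<open>p \<noteq> 0\<close>] card_eq
    by (simp add: roots p card_image[OF inj_to_ac])
qed

text \<open>The multiplicative group of the field with q^2 elements.\<close>

definition unit_roots :: "'a alg_closure set" where
  "unit_roots = {x. x ^ (q\<^sup>2 - 1) = 1}"

text \<open>Since q = 0 in the field, X^(q^2 - 1) - 1 has derivative -X^(q^2 - 2), which vanishes at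
  no nonzero point; hence all roots are simple.\<close>

lemma card_unit_roots: "card unit_roots = q\<^sup>2 - 1"
proof -
  define p :: "'a alg_closure poly" where "p = monom 1 (q\<^sup>2 - 1) - 1"
  have q2: "1 < q\<^sup>2" using q_gt_1 by (intro one_less_power) auto
  have p: "degree p = q\<^sup>2 - 1"
    unfolding p_def diff_conv_add_uminus using q2
    by (subst degree_add_eq_left) (auto simp: degree_monom_eq)
  then have "p \<noteq> 0" using q2 by auto
  have roots: "{x. poly p x = 0} = unit_roots"
    by (auto simp: p_def poly_monom unit_roots_def)
  have "of_nat (q\<^sup>2 - 1) = (of_nat (q\<^sup>2) - 1 :: 'a alg_closure)"
    using q2 by (subst of_nat_diff) auto
  then have minus1: "of_nat (q\<^sup>2 - 1) = (- 1 :: 'a alg_closure)"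
    by (simp add: of_nat_q)
  have "card {x. poly p x = 0} = degree p"
  proof (rule card_roots_eq_degree[OF \<open>p \<noteq> 0\<close>])
    fix x assume "poly p x = 0"
    then have "x \<noteq> 0" using q2 by (auto simp: p_def poly_monom power_0_left)
    then show "poly (pderiv p) x \<noteq> 0"
      by (simp add: p_def pderiv_diff pderiv_monom poly_monom minus1[simplified])
  qed
  with roots p show ?thesis by simp
qed

lemma unit_roots_nonzero: "x \<in> unit_roots \<Longrightarrow> x \<noteq> 0"
  using one_less_power[OF q_gt_1, of 2] by (auto simp: unit_roots_def power_0_left)

lemma unit_roots_power_q2: "x \<in> unit_roots \<Longrightarrow> x ^ (q\<^sup>2) = x"
  using q_gt_1 by (simp add: unit_roots_def power_eq_if[of x "q\<^sup>2"])

lemma unit_roots_power_q_q: "x \<in> unit_roots \<Longrightarrow> (x ^ q) ^ q = x"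
  using unit_roots_power_q2[of x] by (simp add: power_mult power2_eq_square)

text \<open>The base field is too small to contain all q^2 - 1 roots. Together with 1, such a
  \<open>\<theta>\<close> is linearly independent over the base field.\<close>

lemma ex_unit_root_not_fixed: "\<exists>\<theta>\<in>unit_roots. \<theta> ^ q \<noteq> \<theta>"
proof (rule ccontr)
  assume "\<not> ?thesis"
  then have "unit_roots \<subseteq> range (to_ac :: 'a \<Rightarrow> _)" by (auto simp: range_to_ac)
  then have "card unit_roots \<le> card (range (to_ac :: 'a \<Rightarrow> _))"
    by (intro card_mono) auto
  then have "q\<^sup>2 - 1 \<le> q" by (simp add: card_unit_roots card_image[OF inj_to_ac] card_eq)
  moreover have "2 * q \<le> q\<^sup>2" using q_gt_1 by (simp add: power2_eq_square)
  ultimately show False using q_gt_1 by linarith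
qed

end

subsection \<open>The BCH parity checks over the base field\<close>

locale bch_checks = quadratic_extension ty q for ty :: "'a::{field,finite} itself" and q :: nat +
  fixes i :: nat and \<theta> :: "'a alg_closure"
  assumes q_ge: "4 \<le> q" and i_le: "i \<le> q - 3"
    and \<theta>: "\<theta> \<in> unit_roots" "\<theta> ^ q \<noteq> \<theta>"
begin

text \<open>The exponents represent orbits of multiplication by q modulo q^2 - 1. An orbit of size
  two carries two functionals, told apart by the Boolean; 0 and \<open>q + 1\<close> are alone in
  their orbits and carry one. The exponent \<open>q\<close> is absent because it lies in the orbit
  of 1.\<close>

definition lower_checks :: "(nat \<times> bool) set" where
  "lower_checks = {0..<q} \<times> {False} \<union> {1..<q} \<times> {True}"

definition upper_checks :: "(nat \<times> bool) set" where
  "upper_checks = {q+1..q+1+i} \<times> {False} \<union> {q+2..q+1+i} \<times> {True}"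

lemma finite_checks [simp]: "finite lower_checks" "finite upper_checks"
  by (simp_all add: lower_checks_def upper_checks_def)

lemma card_lower_checks: "card lower_checks = 2 * q - 1"
  unfolding lower_checks_def using q_ge by (subst card_Un_disjoint) auto

lemma card_upper_checks: "card upper_checks = 2 * i + 1"
  unfolding upper_checks_def by (subst card_Un_disjoint) auto

lemma checks_disjoint: "lower_checks \<inter> upper_checks = {}"
  by (auto simp: lower_checks_def upper_checks_def)

definition scalar :: "bool \<Rightarrow> 'a alg_closure" where
  "scalar \<tau> = (if \<tau> then \<theta> else 1)"

text \<open>In general these are the multiples of \<open>q + 1\<close>; the exponents in use stay
  below \<open>2 * (q + 1)\<close>.\<close>

definition singleton_coset :: "nat \<Rightarrow> bool" where
  "singleton_coset e \<longleftrightarrow> e = 0 \<or> e = q + 1"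

text \<open>The remainder of \<open>q e\<close> modulo \<open>q\<^sup>2 - 1\<close> for the exponents \<open>e\<close> in use.\<close>
definition conj_exp :: "nat \<Rightarrow> nat" where
  "conj_exp e = (if e < q then q * e else q * e - (q\<^sup>2 - 1))"

text \<open>Check \<open>(e, \<tau>)\<close> is the functional mapping \<open>c\<close> to the trace of \<open>scalar \<tau>\<close> times the syndrome
  of \<open>c\<close> at \<open>e\<close>; the scalars 1 and \<open>\<theta>\<close> together recover the syndrome. If \<open>q e = e\<close> modulo \<open>q\<^sup>2 - 1\<close>,
  the syndrome already lies in the base field and is itself the only functional.\<close>
definition check_poly :: "nat \<times> bool \<Rightarrow> 'a alg_closure poly" where
  "check_poly = (\<lambda>(e, \<tau>). if singleton_coset e then monom 1 e
     else monom (scalar \<tau>) e + monom (scalar \<tau> ^ q) (conj_exp e))"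

text \<open>Agrees with \<open>check_poly\<close> on \<open>unit_roots\<close>. The polynomial has
  reduced exponents, which serves independence; here the \<open>q\<close>-th power is kept visible,
  which serves Frobenius arguments.\<close>

definition check_value :: "nat \<times> bool \<Rightarrow> 'a alg_closure \<Rightarrow> 'a alg_closure" where
  "check_value = (\<lambda>(e, \<tau>) x. if singleton_coset e then x ^ e
     else scalar \<tau> * x ^ e + scalar \<tau> ^ q * (x ^ e) ^ q)"

section \<open>Exponent arithmetic modulo q^2 - 1\<close>

lemma check_exp_bounds:
  assumes "(e, \<tau>) \<in> lower_checks \<union> upper_checks"
  shows "e < q \<or> q + 1 \<le> e \<and> e \<le> q + 1 + i"
  using assms by (auto simp: lower_checks_def upper_checks_def)

lemma q2_eq: "q\<^sup>2 = q * q" by (simp add: power2_eq_square)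

lemma conj_exp_high: "e = q + 1 + t \<Longrightarrow> conj_exp e = q + 1 + q * t"
  using q_gt_1 by (simp add: conj_exp_def q2_eq algebra_simps)

lemma exp_lt:
  assumes "(e, \<tau>) \<in> lower_checks \<union> upper_checks"
  shows "e < q\<^sup>2 - 1"
proof -
  have "4 * q \<le> q\<^sup>2" using q_ge by (simp add: q2_eq)
  then show ?thesis using check_exp_bounds[OF assms] q_ge i_le by linarith
qed

lemma conj_exp_lt:
  assumes "(e, \<tau>) \<in> lower_checks \<union> upper_checks"
  shows "conj_exp e < q\<^sup>2 - 1"
proof (cases "e < q")
  case True
  then have "q * e \<le> q * (q - 1)" by (intro mult_le_mono2) simp
  also have "\<dots> = q\<^sup>2 - q" by (simp add: q2_eq diff_mult_distrib2)
  finally have "q * e \<le> q\<^sup>2 - q" .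
  moreover have "4 * q \<le> q\<^sup>2" using q_ge by (simp add: q2_eq)
  ultimately show ?thesis using True q_ge by (simp add: conj_exp_def)
next
  case False
  then obtain t where t: "e = q + 1 + t" "t \<le> i"
    using check_exp_bounds[OF assms] by (auto simp: le_iff_add)
  have "q * t \<le> q * (q - 3)" using t i_le by (intro mult_le_mono2) simp
  also have "\<dots> = q\<^sup>2 - 3 * q" by (simp add: q2_eq diff_mult_distrib2)
  finally have "q * t \<le> q\<^sup>2 - 3 * q" .
  moreover have "4 * q \<le> q\<^sup>2" using q_ge by (simp add: q2_eq)
  ultimately show ?thesis using conj_exp_high[OF t(1)] q_ge by simp
qed

text \<open>The conjugate exponent is \<open>q\<close> for \<open>e = 1\<close> and at least
  \<open>2 * q\<close> otherwise, whereas the exponents in use omit \<open>q\<close> and, as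
  \<open>i \<le> q - 3\<close>, end at \<open>2 * q - 2\<close> or earlier.\<close>

lemma conj_exp_neq:
  assumes e: "(e, \<tau>) \<in> lower_checks \<union> upper_checks" "\<not> singleton_coset e" and e': "(e', \<tau>') \<in> lower_checks \<union> upper_checks"
  shows "conj_exp e \<noteq> e'"
proof -
  have "conj_exp e = q \<or> 2 * q \<le> conj_exp e"
  proof (cases "e < q")
    case True
    then have "e = 1 \<or> 2 \<le> e" using e(2) by (auto simp: singleton_coset_def)
    then show ?thesis
    proof
      assume "2 \<le> e"
      then have "q * 2 \<le> q * e" by (rule mult_le_mono2)
      with True show ?thesis by (simp add: conj_exp_def)
    qed (use q_gt_1 in \<open>simp add: conj_exp_def\<close>)
  next
    case False
    then obtain t where t: "e = q + 1 + t"
      using check_exp_bounds[OF e(1)] by (auto simp: le_iff_add)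
    then have "1 \<le> t" using e(2) by (auto simp: singleton_coset_def)
    then have "q * 1 \<le> q * t" by (rule mult_le_mono2)
    with conj_exp_high[OF t] show ?thesis by linarith
  qed
  with check_exp_bounds[OF e'] i_le q_ge show ?thesis by linarith
qed

lemma unit_roots_power_conj_exp:
  assumes "x \<in> unit_roots" "(e, \<tau>) \<in> lower_checks \<union> upper_checks"
  shows "x ^ conj_exp e = (x ^ e) ^ q"
proof (cases "e < q")
  case True
  then show ?thesis by (simp add: conj_exp_def mult.commute flip: power_mult)
next
  case False
  then obtain t where t: "e = q + 1 + t"
    using check_exp_bounds[OF assms(2)] by (auto simp: le_iff_add)
  have "q * e = (q\<^sup>2 - 1) + conj_exp e"
    using conj_exp_high[OF t] q_gt_1 unfolding q2_eq by (simp add: t algebra_simps)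
  then have "x ^ (q * e) = x ^ (q\<^sup>2 - 1) * x ^ conj_exp e" by (simp add: power_add)
  moreover have "(x ^ e) ^ q = x ^ (q * e)" by (simp add: mult.commute flip: power_mult)
  ultimately have "(x ^ e) ^ q = x ^ (q\<^sup>2 - 1) * x ^ conj_exp e" by simp
  then show ?thesis using assms(1) by (simp add: unit_roots_def)
qed

lemma poly_check_poly:
  assumes "x \<in> unit_roots" "k \<in> lower_checks \<union> upper_checks"
  shows "poly (check_poly k) x = check_value k x"
  using assms unit_roots_power_conj_exp[of x "fst k" "snd k"]
  by (cases k) (auto simp: check_poly_def check_value_def poly_monom)

lemma degree_check_poly:
  assumes "k \<in> lower_checks \<union> upper_checks"
  shows "degree (check_poly k) < q\<^sup>2 - 1"
proof -
  obtain e \<tau> where k: "k = (e, \<tau>)" by (cases k)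
  have "degree (monom c e) < q\<^sup>2 - 1"
    "degree (monom c (conj_exp e)) < q\<^sup>2 - 1" for c :: "'a alg_closure"
    using exp_lt[of e \<tau>] conj_exp_lt[of e \<tau>] assms
    by (auto simp: k intro: le_less_trans[OF degree_monom_le])
  then show ?thesis
    by (auto simp: k check_poly_def intro: degree_add_less)
qed

lemma coeff_check_poly:
  assumes "(e, \<tau>) \<in> lower_checks \<union> upper_checks" "(e', \<tau>') \<in> lower_checks \<union> upper_checks"
  shows "coeff (check_poly (e, \<tau>)) e' = of_bool (e = e') * scalar \<tau>"
proof (cases "singleton_coset e")
  case True
  then have "\<not> \<tau>" using assms(1) by (auto simp: lower_checks_def upper_checks_def singleton_coset_def)
  with True show ?thesis by (auto simp: check_poly_def scalar_def)
next
  case False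
  then show ?thesis
    using conj_exp_neq[OF assms(1) False assms(2)] by (auto simp: check_poly_def)
qed

lemma scalar_power_q_q: "(scalar \<tau> ^ q) ^ q = scalar \<tau>"
  using unit_roots_power_q_q[OF \<theta>(1)] by (simp add: scalar_def)

text \<open>The \<open>q\<close>-th power swaps the two summands of a trace and fixes the norm
  \<open>x ^ (q + 1)\<close>; fixed elements come from the base field.\<close>

lemma check_value_in_base_field:
  assumes "x \<in> unit_roots" "k \<in> lower_checks \<union> upper_checks"
  shows "to_ac (of_ac (check_value k x)) = check_value k x"
proof -
  obtain e \<tau> where k: "k = (e, \<tau>)" by (cases k)
  have xe: "((x ^ e) ^ q) ^ q = x ^ e"
    using unit_roots_power_q_q[OF assms(1)] by (metis power_mult mult.commute)
  have "check_value k x ^ q = check_value k x"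
  proof (cases "singleton_coset e")
    case True
    have "(x ^ (q + 1)) ^ q = (x ^ q) ^ q * x ^ q"
      by (simp add: power_mult_distrib)
    also have "\<dots> = x ^ (q + 1)"
      using unit_roots_power_q_q[OF assms(1)] by simp
    finally have "(x ^ (q + 1)) ^ q = x ^ (q + 1)" .
    with True show ?thesis by (auto simp: k check_value_def singleton_coset_def)
  next
    case False
    then show ?thesis
      by (simp add: k check_value_def frobenius_add power_mult_distrib xe scalar_power_q_q add.commute)
  qed
  then show ?thesis
    by (intro to_ac_of_ac) (simp add: range_to_ac)
qed

text \<open>A relation is a polynomial of degree below q^2 - 1 vanishing at q^2 - 1 points, hence
  zero. Conjugate exponents never meet the exponents in use, so its coefficient at \<open>e\<close>
  involves only the one or two checks at \<open>e\<close>, which 1 and \<open>\<theta>\<close>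
  separate.\<close>

lemma checks_independent:
  fixes c :: "nat \<times> bool \<Rightarrow> 'a"
  assumes zero: "\<And>x. x \<in> unit_roots \<Longrightarrow> (\<Sum>k\<in>lower_checks \<union> upper_checks. to_ac (c k) * check_value k x) = 0"
    and k: "k \<in> lower_checks \<union> upper_checks"
  shows "c k = 0"
proof -
  define p where "p = (\<Sum>k\<in>lower_checks \<union> upper_checks. smult (to_ac (c k)) (check_poly k))"
  have q2: "0 < q\<^sup>2 - 1" using degree_check_poly[OF k] by simp
  have "p = 0"
  proof (rule poly_eqI_degree)
    fix x assume "x \<in> unit_roots"
    then show "poly p x = poly 0 x"
      using zero by (simp add: p_def poly_sum poly_check_poly)
  next
    show "degree p < card unit_roots"
      unfolding p_def card_unit_roots using q2
      by (intro degree_sum_less le_less_trans[OF degree_smult_le degree_check_poly])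
    show "degree (0 :: 'a alg_closure poly) < card unit_roots"
      using q2 by (simp add: card_unit_roots)
  qed
  obtain e \<tau> where e: "k = (e, \<tau>)" by (cases k)
  have "0 = coeff p e" by (simp add: \<open>p = 0\<close>)
  also have "\<dots> = (\<Sum>(e', \<tau>')\<in>lower_checks \<union> upper_checks. to_ac (c (e', \<tau>')) * (of_bool (e' = e) * scalar \<tau>'))"
    unfolding p_def coeff_sum using coeff_check_poly[OF _ k[unfolded e]]
    by (intro sum.cong refl) (auto split: prod.splits)
  also have "\<dots> = (\<Sum>(e', \<tau>')\<in>(lower_checks \<union> upper_checks) \<inter> {(e, False), (e, True)}. to_ac (c (e', \<tau>')) * scalar \<tau>')"
    by (intro sum.mono_neutral_cong_right) auto
  finally have eq: "(\<Sum>(e', \<tau>')\<in>(lower_checks \<union> upper_checks) \<inter> {(e, False), (e, True)}. to_ac (c (e', \<tau>')) * scalar \<tau>') = 0"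
    by simp
  show ?thesis
  proof (cases "(e, True) \<in> lower_checks \<union> upper_checks")
    case False
    then have "\<not> \<tau>" "(lower_checks \<union> upper_checks) \<inter> {(e, False), (e, True)} = {(e, False)}"
      using k e by (cases \<tau>; auto)+
    with eq show ?thesis by (simp add: e scalar_def)
  next
    case True
    then have "(lower_checks \<union> upper_checks) \<inter> {(e, False), (e, True)} = {(e, False), (e, True)}"
      by (auto simp: lower_checks_def upper_checks_def)
    with eq have eq': "to_ac (c (e, False)) + to_ac (c (e, True)) * \<theta> = 0"
      by (simp add: scalar_def)
    have "c (e, True) = 0"
    proof (rule ccontr)
      assume "c (e, True) \<noteq> 0"
      with eq' have "\<theta> = to_ac (- c (e, False) / c (e, True))"
        by (simp add: field_simps eq_neg_iff_add_eq_0)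
      with to_ac_power_q \<theta>(2) show False by metis
    qed
    with eq' e show ?thesis by (cases \<tau>) auto
  qed
qed

text \<open>As \<open>c\<close> has values in the base field, the two checks at \<open>e\<close>
  form a linear system in the syndrome \<open>s\<close> and \<open>s ^ q\<close>, with determinant
  \<open>\<theta> ^ q - \<theta>\<close>, which is nonzero.\<close>

lemma syndrome_eq_0_of_checks:
  fixes c :: "nat \<Rightarrow> 'a" and \<alpha> :: "nat \<Rightarrow> 'a alg_closure"
  assumes "(e, False) \<in> I"
    and I: "I = lower_checks \<or> I = upper_checks"
    and zero: "\<And>k. k \<in> I \<Longrightarrow> (\<Sum>l<n. check_value k (\<alpha> l) * to_ac (c l)) = 0"
  shows "(\<Sum>l<n. to_ac (c l) * \<alpha> l ^ e) = 0"
proof (cases "singleton_coset e")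
  case True
  with zero[OF assms(1)] show ?thesis by (simp add: check_value_def mult.commute)
next
  case False
  then have eT: "(e, True) \<in> I"
    using assms(1) I by (auto simp: lower_checks_def upper_checks_def singleton_coset_def)
  define s where "s = (\<Sum>l<n. to_ac (c l) * \<alpha> l ^ e)"
  have sq: "s ^ q = (\<Sum>l<n. to_ac (c l) * (\<alpha> l ^ e) ^ q)"
    unfolding s_def frobenius_sum by (simp add: power_mult_distrib to_ac_power_q)
  have *: "scalar \<tau> * s + scalar \<tau> ^ q * s ^ q = 0" if "(e, \<tau>) \<in> I" for \<tau>
  proof -
    have "scalar \<tau> * s + scalar \<tau> ^ q * s ^ q = (\<Sum>l<n. check_value (e, \<tau>) (\<alpha> l) * to_ac (c l))"
      unfolding sq unfolding s_def using False
      by (simp add: check_value_def sum_distrib_left algebra_simps flip: sum.distrib)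
    with zero[OF that] show ?thesis by simp
  qed
  have "s ^ q = - s" using *[OF assms(1)] by (simp add: scalar_def eq_neg_iff_add_eq_0 add.commute)
  with *[OF eT] have "(\<theta> - \<theta> ^ q) * s = 0" by (simp add: scalar_def algebra_simps)
  with \<theta>(2) show ?thesis by (simp add: s_def)
qed

end

section \<open>Assembly of the code\<close>

theorem theorem5p5:
  fixes q n i :: nat
  assumes "primepow q" and "q \<ge> 4"
    and "CARD('a::{field,finite}) = q"
    and "n = q^2 - 1"
    and "1 \<le> i" and "i \<le> q - 3"
  shows "\<exists>C :: 'a poly vec set.
           convolutional_code n (n - 2 * q + 1) (2 * i + 1) 1 C \<and>
           free_distance C \<ge> q + i + 3"
proof -
  interpret quadratic_extension "TYPE('a)" q
    using assms by unfold_locales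
  obtain \<theta> where \<theta>: "\<theta> \<in> unit_roots" "\<theta> ^ q \<noteq> \<theta>" using ex_unit_root_not_fixed by blast
  interpret bch_checks "TYPE('a)" q i \<theta>
    using assms \<theta> by unfold_locales
  define r where "r = 2 * q - 1"
  define s where "s = 2 * i + 1"
  \<comment> \<open>There is room for all checks:
    \<open>r + s = 2 * (q + i) \<le> 4 * q - 6\<close>. No subtraction is truncated.\<close>
  have "4 * q \<le> q\<^sup>2" using assms(2) by (simp add: q2_eq)
  then have rs: "s \<le> r" "r + s \<le> n" "n - r = n - 2 * q + 1"
    using assms by (simp_all add: r_def s_def)
  have "finite unit_roots" "card unit_roots = n"
    using card_unit_roots \<open>4 * q \<le> q\<^sup>2\<close> assms by (auto intro: card_ge_0_finite)
  then obtain \<alpha> where \<alpha>: "bij_betw \<alpha> {..<n} unit_roots"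
    using ex_bij_betw_nat_finite by (metis atLeast0LessThan)
  then have inj: "inj_on \<alpha> {..<n}" and \<alpha>_in: "\<And>l. l < n \<Longrightarrow> \<alpha> l \<in> unit_roots"
    by (auto simp: bij_betw_def)
  obtain f where f: "bij_betw f {..<r} lower_checks"
    using ex_bij_betw_nat_finite[OF finite_checks(1)] by (metis atLeast0LessThan card_lower_checks r_def)
  obtain g where g: "bij_betw g {..<s} upper_checks"
    using ex_bij_betw_nat_finite[OF finite_checks(2)] by (metis atLeast0LessThan card_upper_checks s_def)
  \<comment> \<open>Lower checks come first and upper checks next, the row order of
    \<open>H\<^sub>0\<close> and \<open>H\<^sub>1\<close>.\<close>
  define F where "F = (\<lambda>j. if j < r then f j else g (j - r))"
  have F0: "bij_betw F {..<r} lower_checks"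
    using f by (rule bij_betw_cong[THEN iffD1, rotated]) (simp add: F_def)
  have "bij_betw (\<lambda>j. j - r) {r..<r+s} {..<s}"
    by (rule bij_betw_byWitness[where f' = "\<lambda>j. j + r"]) auto
  from bij_betw_trans[OF this g] have F1: "bij_betw F {r..<r+s} upper_checks"
    by (rule bij_betw_cong[THEN iffD1, rotated]) (simp add: F_def)
  have F: "bij_betw F {..<r+s} (lower_checks \<union> upper_checks)"
    using bij_betw_combine[OF F0 F1 checks_disjoint] by (simp add: ivl_disj_un)
  have FI: "F j \<in> lower_checks \<union> upper_checks" if "j < r + s" for j
    using F that by (auto simp: bij_betw_def)
  define R where "R = (\<lambda>j l. of_ac (check_value (F j) (\<alpha> l)))"
  have R: "to_ac (R j l) = check_value (F j) (\<alpha> l)" if "j < r + s" "l < n" for j l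
    unfolding R_def using that by (intro check_value_in_base_field \<alpha>_in FI)
  have "independent_rows (r + s) n R"
    unfolding independent_rows_def
  proof (intro allI impI)
    fix c j assume c: "\<forall>l<n. (\<Sum>j<r+s. c j * R j l) = 0" and j: "j < r + s"
    define c' where "c' k = c (the_inv_into {..<r+s} F k)" for k
    have inv: "the_inv_into {..<r+s} F (F j) = j" if "j < r + s" for j
      using F that by (intro the_inv_into_f_f) (auto simp: bij_betw_def)
    have "c' (F j) = 0"
    proof (rule checks_independent[OF _ FI[OF j]])
      fix x assume "x \<in> unit_roots"
      then obtain l where l: "l < n" "x = \<alpha> l"
        using \<alpha> by (auto simp: bij_betw_def)
      have "(\<Sum>k\<in>lower_checks \<union> upper_checks. to_ac (c' k) * check_value k x)
          = (\<Sum>j<r+s. to_ac (c' (F j)) * check_value (F j) x)"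
        by (rule sum.reindex_bij_betw[OF F, symmetric])
      also have "\<dots> = (\<Sum>j<r+s. to_ac (c j * R j l))"
        using l by (intro sum.cong) (auto simp: c'_def inv R)
      also have "\<dots> = to_ac (\<Sum>j<r+s. c j * R j l)" by (simp only: to_ac_sum)
      also have "\<dots> = 0" using c l by simp
      finally show "(\<Sum>k\<in>lower_checks \<union> upper_checks. to_ac (c' k) * check_value k x) = 0" .
    qed
    with j show "c j = 0" by (simp add: c'_def inv)
  qed
  from independent_rows_extend[OF this rs(2)] obtain Q
    where Q: "\<And>j. j < r + s \<Longrightarrow> Q j = R j" and indep: "independent_rows n n Q" by blast
  obtain P where P: "\<And>a b. a < n \<Longrightarrow> b < n \<Longrightarrow> (\<Sum>l<n. Q a l * P l b) = of_bool (a = b)"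
    using independent_rows_inverse[OF indep] by blast
  interpret unit_memory_code n r s Q P
    using P rs by unfold_locales (auto simp: s_def)
  have checks: "(\<Sum>l<n. check_value (F j) (\<alpha> l) * to_ac (c l)) = 0"
    if "(\<Sum>l<n. Q j l * c l) = 0" "j < r + s" for j and c :: "nat \<Rightarrow> 'a"
  proof -
    have "(\<Sum>l<n. check_value (F j) (\<alpha> l) * to_ac (c l)) = to_ac (\<Sum>l<n. Q j l * c l)"
      unfolding to_ac_sum using that(2) by (intro sum.cong) (auto simp: Q R)
    with that(1) show ?thesis by simp
  qed
  have low: "(\<Sum>l<n. to_ac (c l) * \<alpha> l ^ e) = 0"
    if c: "\<And>a. a < r \<Longrightarrow> (\<Sum>l<n. Q a l * c l) = 0" and "e \<le> q" for c e
  proof -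
    have *: "(\<Sum>l<n. to_ac (c l) * \<alpha> l ^ e) = 0" if "e < q" for e
    proof (rule syndrome_eq_0_of_checks[of _ lower_checks])
      fix k assume "k \<in> lower_checks"
      then obtain j where "j < r" "k = F j" using F0 by (auto simp: bij_betw_def)
      then show "(\<Sum>l<n. check_value k (\<alpha> l) * to_ac (c l)) = 0"
        using c checks by simp
    qed (use that in \<open>auto simp: lower_checks_def\<close>)
    show ?thesis
    proof (cases "e = q")
      \<comment> \<open>The exponent \<open>q\<close> is conjugate to 1, so this syndrome is the
        \<open>q\<close>-th power of the one at 1. It closes the gap between the lower and the upper
        exponents.\<close>
      case True
      have "(\<Sum>l<n. to_ac (c l) * \<alpha> l ^ 1) ^ q = (\<Sum>l<n. to_ac (c l) * \<alpha> l ^ e)"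
        by (simp add: frobenius_sum power_mult_distrib to_ac_power_q True)
      with *[of 1] q_gt_1 show ?thesis by (simp add: power_0_left)
    next
      case False
      with *[of e] \<open>e \<le> q\<close> show ?thesis by simp
    qed
  qed
  have high: "(\<Sum>l<n. to_ac (c l) * \<alpha> l ^ e) = 0"
    if c: "\<And>a. r \<le> a \<Longrightarrow> a < r + s \<Longrightarrow> (\<Sum>l<n. Q a l * c l) = 0"
      and e: "q + 1 \<le> e" "e \<le> q + 1 + i" for c e
  proof (rule syndrome_eq_0_of_checks[of _ upper_checks])
    fix k assume "k \<in> upper_checks"
    then have "k \<in> F ` {r..<r+s}" using F1 by (simp add: bij_betw_def)
    then obtain j where "r \<le> j" "j < r + s" "k = F j" by auto
    then show "(\<Sum>l<n. check_value k (\<alpha> l) * to_ac (c l)) = 0"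
      using c checks by simp
  qed (use e in \<open>auto simp: upper_checks_def\<close>)
  have bch: "\<delta> < card {l. l < n \<and> c l \<noteq> 0}"
    if "\<And>j. j < \<delta> \<Longrightarrow> (\<Sum>l<n. to_ac (c l) * \<alpha> l ^ (b + j)) = 0" "\<exists>l<n. c l \<noteq> 0"
    for \<delta> b and c :: "nat \<Rightarrow> 'a"
    using bch_bound[of "{..<n}" \<alpha> \<delta> "\<lambda>l. to_ac (c l)" b] inj \<alpha>_in unit_roots_nonzero that by auto
  \<comment> \<open>The runs of zeros are \<open>0, ..., q\<close> for the lower checks,
    \<open>q + 1, ..., q + 1 + i\<close> for the upper ones and \<open>0, ..., q + 1 + i\<close> for
    both; each distance exceeds the length of its run by one. The minimum is
    \<open>q + i + 3\<close>.\<close>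
  have "min ((q + 2) + (i + 2)) (q + i + 3) \<le> free_distance (generated_code G)"
  proof (rule free_distance_G_ge)
    fix c :: "nat \<Rightarrow> 'a"
    assume nz: "\<exists>l<n. c l \<noteq> 0"
    show "q + 2 \<le> card {l. l < n \<and> c l \<noteq> 0}"
      if "\<And>a. a < r \<Longrightarrow> (\<Sum>l<n. Q a l * c l) = 0"
      using bch[of "q + 1" c 0] low[of c] that nz by simp
    show "i + 2 \<le> card {l. l < n \<and> c l \<noteq> 0}"
      if "\<And>a. r \<le> a \<Longrightarrow> a < r + s \<Longrightarrow> (\<Sum>l<n. Q a l * c l) = 0"
    proof -
      have "i + 1 < card {l. l < n \<and> c l \<noteq> 0}"
        by (rule bch[where b = "q + 1"], rule high) (use that nz in auto)
      then show ?thesis by simp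
    qed
    show "q + i + 3 \<le> card {l. l < n \<and> c l \<noteq> 0}"
      if "\<And>a. a < r + s \<Longrightarrow> (\<Sum>l<n. Q a l * c l) = 0"
    proof -
      have "(\<Sum>l<n. to_ac (c l) * \<alpha> l ^ e) = 0" if "e < q + i + 2" for e
        using low[of c e] high[of c e] \<open>\<And>a. a < r + s \<Longrightarrow> (\<Sum>l<n. Q a l * c l) = 0\<close> that
        by (cases "e \<le> q") auto
      with bch[of "q + i + 2" c 0] nz show ?thesis by simp
    qed
  qed
  then show ?thesis
    using convolutional_code_G rs(3) by (intro exI[of _ "generated_code G"]) (simp add: s_def)
qed

end
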